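(* Let $G$ be any graph and, for each integer $k\ge 0$, let $G_k$ be the graph obtained from $G$ by attaching $k$ pendant edges at each vertex of $G$ (that is, for each vertex $u$ of $G$, adding $k$ new vertices each adjacent only to $u$). Then for all sufficiently large $k$ (how large depending on $G$), $G_k$ has log-concave (and hence unimodal) independent set sequence.
   Context: All graphs are simple, finite and loopless. An independent set in a graph $H$ is a set of pairwise non-adjacent vertices; $i_H(t)$ is the number of independent sets of size $t$ in $H$, $\alpha(H)$ is the size of the largest independent set, and the independent set sequence of $H$ is $(i_H(t))_{t=0}^{\alpha(H)}$. A finite real sequence $(a_0,\dots,a_n)$ is log-concave if $a_k^2\ge a_{k-1}a_{k+1}$ for $k=1,\dots,n-1$, and unimodal if there is $m$, $0\le m\le n$, with $a_0\le a_1\le\dots\le a_m\ge a_{m+1}\ge\dots\ge a_n$. *)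

theory Defs
  imports Complex_Main "Graph_Theory.Pair_Digraph"
begin

text \<open>
  A finite simple graph is a \<^typ>\<open>'a pair_pre_digraph\<close> satisfying \<^locale>\<open>pair_graph\<close>:
  finitely many vertices and a symmetric, irreflexive set of arcs on them, so that the two
  opposite arcs between adjacent vertices stand for one edge. The null graph is allowed.
\<close>

definition independent_set :: "'a pair_pre_digraph \<Rightarrow> 'a set \<Rightarrow> bool" where
  "independent_set H S \<longleftrightarrow> S \<subseteq> pverts H \<and> (\<forall>u\<in>S. \<forall>v\<in>S. (u, v) \<notin> parcs H)"

definition num_indep :: "'a pair_pre_digraph \<Rightarrow> nat \<Rightarrow> nat" where
  "num_indep H t = card {S. independent_set H S \<and> card S = t}"

definition independence_number :: "'a pair_pre_digraph \<Rightarrow> nat" where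
  "independence_number H = Max {card S | S. independent_set H S}"

text \<open>
  A finite sequence \<open>(a\<^sub>0, \<dots>, a\<^sub>n)\<close> is given by its last index \<open>n\<close> and a function \<open>a\<close>
  whose values beyond \<open>n\<close> are ignored.
\<close>

definition log_concave_seq :: "nat \<Rightarrow> (nat \<Rightarrow> real) \<Rightarrow> bool" where
  "log_concave_seq n a \<longleftrightarrow> (\<forall>k\<in>{1..<n}. (a k)\<^sup>2 \<ge> a (k - 1) * a (k + 1))"

definition unimodal_seq :: "nat \<Rightarrow> (nat \<Rightarrow> real) \<Rightarrow> bool" where
  "unimodal_seq n a \<longleftrightarrow>
     (\<exists>m\<le>n. (\<forall>i<m. a i \<le> a (i + 1)) \<and> (\<forall>i\<in>{m..<n}. a i \<ge> a (i + 1)))"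

text \<open>
  In the graph with \<open>k\<close> pendant edges attached at every vertex, \<open>Inl u\<close> is the original
  vertex \<open>u\<close>, and \<open>Inr (u, j)\<close> for \<open>j < k\<close> are the new vertices adjacent only to it.
\<close>

definition attach_pendants :: "nat \<Rightarrow> 'a pair_pre_digraph \<Rightarrow> ('a + 'a \<times> nat) pair_pre_digraph" where
  "attach_pendants k G = \<lparr>
     pverts = Inl ` pverts G \<union> Inr ` (pverts G \<times> {..<k}),
     parcs = {(Inl u, Inl v) | u v. (u, v) \<in> parcs G}
       \<union> {(Inl u, Inr (u, j)) | u j. u \<in> pverts G \<and> j < k}
       \<union> {(Inr (u, j), Inl u) | u j. u \<in> pverts G \<and> j < k} \<rparr>"

lemma pair_graph_attach_pendants:
  assumes "pair_graph G"
  shows "pair_graph (attach_pendants k G)"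
proof -
  interpret pair_graph G by fact
  let ?H = "attach_pendants k G"
  have wf: "e \<in> parcs ?H \<Longrightarrow> fst e \<in> pverts ?H \<and> snd e \<in> pverts ?H" for e
    by (auto simp: attach_pendants_def dest: in_arcsD1 in_arcsD2)
  have fin: "finite (pverts ?H)"
    by (simp add: attach_pendants_def pair_finite_verts)
  have "parcs ?H \<subseteq> pverts ?H \<times> pverts ?H"
    using wf by (auto simp: mem_Times_iff)
  then have fin_arcs: "finite (parcs ?H)"
    using fin by (meson finite_SigmaI finite_subset)
  have "sym (parcs G)"
    using pair_sym_arcs by (simp add: symmetric_def)
  then have "sym (parcs ?H)"
    by (auto simp: attach_pendants_def sym_def)
  moreover have "e \<in> parcs ?H \<Longrightarrow> fst e \<noteq> snd e" for e
    using pair_no_loops by (fastforce simp: attach_pendants_def)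
  ultimately show ?thesis
    using wf fin fin_arcs by unfold_locales (auto simp: symmetric_def)
qed

end

theory Submission
  imports Defs "HOL-Real_Asymp.Real_Asymp"
begin

text \<open>
  Let \<open>n\<close> be the number of vertices of \<open>G\<close> and \<open>N = k n\<close>. The independent sets of \<open>G\<^sub>k\<close> of size
  \<open>t\<close> that avoid \<open>G\<close> are counted by \<open>N choose t\<close>, and for each of the fewer than \<open>2 ^ n\<close> other
  possible traces on \<open>G\<close> there are at most \<open>(N - k) choose (t - 1)\<close> of them. The ratio of the second
  binomial to the first is at most \<open>(t / k) q ^ (t - 1)\<close> with \<open>q = 1 - 1 / n\<close>, so the relative
  perturbation of the binomial sequence is below \<open>1 / (3 (t + 1))\<close>, uniformly in \<open>t\<close>, once \<open>k\<close> is
  large. This is absorbed by the room \<open>1 + 1 / t\<close> in the log-concavity of binomial coefficients.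
\<close>

section \<open>From log-concavity to unimodality\<close>

text \<open>Once a positive log-concave sequence fails to increase, it never increases again:
  \<open>a (i + 1) \<le> a i\<close> turns log-concavity at \<open>i + 1\<close> into
  \<open>a i * a (i + 2) \<le> a i * a (i + 1)\<close>, and positivity cancels
  \<open>a i\<close>.\<close>

lemma log_concave_seq_imp_unimodal_seq:
  fixes a :: "nat \<Rightarrow> real"
  assumes lc: "log_concave_seq n a" and pos: "\<And>i. i \<le> n \<Longrightarrow> a i > 0"
  shows "unimodal_seq n a"
proof -
  \<comment> \<open>The peak is the first non-ascent; the disjunct \<open>i = n\<close> ensures that
    one exists and that \<open>m \<le> n\<close>.\<close>
  define m where "m = (LEAST i. i = n \<or> a i \<ge> a (i + 1))"
  have m: "m = n \<or> a m \<ge> a (m + 1)"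
    unfolding m_def by (rule LeastI[of _ n]) simp
  have "m \<le> n"
    unfolding m_def by (rule Least_le) simp
  have "a i \<le> a (i + 1)" if "i < m" for i
    using not_less_Least[of i "\<lambda>i. i = n \<or> a i \<ge> a (i + 1)"] that by (auto simp: m_def)
  moreover have "i < n \<Longrightarrow> a i \<ge> a (i + 1)" if "m \<le> i" for i
    using that
  proof (induction i rule: dec_induct)
    case base
    then show ?case using m by auto
  next
    case (step i)
    then have IH: "a (Suc i) \<le> a i" and i: "Suc i < n"
      by auto
    have "a i * a (Suc (Suc i)) \<le> (a (Suc i))\<^sup>2"
      using lc i unfolding log_concave_seq_def by (auto dest!: bspec[of _ _ "Suc i"])
    also have "\<dots> \<le> a i * a (Suc i)"
      using IH pos[of "Suc i"] i by (simp add: power2_eq_square mult_right_mono)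
    finally show ?case
      using pos[of i] i by simp
  qed
  ultimately show ?thesis
    unfolding unimodal_seq_def using \<open>m \<le> n\<close> by auto
qed

section \<open>Estimates for binomial coefficients\<close>

lemma Suc_times_binomial_eq: "Suc j * (N choose Suc j) = (N - j) * (N choose j)"
proof (cases N)
  case (Suc M)
  then show ?thesis
    by (metis binomial_absorption binomial_absorb_comp diff_Suc_1)
qed simp

text \<open>Raising \<open>j\<close> by one multiplies the two binomials by
  \<open>(M - j) / (j + 1)\<close> and \<open>(N - j) / (j + 1)\<close>, and
  \<open>(M - j) / (N - j) \<le> M / N\<close>. Beyond \<open>M\<close> the left side
  vanishes.\<close>

lemma binomial_le_power_times_binomial:
  fixes M N j :: nat
  assumes "M \<le> N" "N > 0"
  shows "real (M choose j) \<le> (real M / real N) ^ j * real (N choose j)"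
proof (induction j)
  case (Suc j)
  show ?case
  proof (cases "j \<le> M")
    case True
    have "real (Suc j) * real (M choose Suc j) = real (M - j) * real (M choose j)"
      unfolding of_nat_mult[symmetric] Suc_times_binomial_eq ..
    also have "\<dots> \<le> (real M / real N * real (N - j)) * ((real M / real N) ^ j * real (N choose j))"
    proof (rule mult_mono[OF _ Suc])
      show "real (M - j) \<le> real M / real N * real (N - j)"
        using assms True by (simp add: of_nat_diff field_simps mult_right_mono)
    qed auto
    also have "\<dots> = (real M / real N) ^ Suc j * (real (N - j) * real (N choose j))"
      by simp
    also have "\<dots> = (real M / real N) ^ Suc j * (real (Suc j) * real (N choose Suc j))"
      unfolding of_nat_mult[symmetric] Suc_times_binomial_eq ..
    finally have "real (Suc j) * real (M choose Suc j)
        \<le> real (Suc j) * ((real M / real N) ^ Suc j * real (N choose Suc j))"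
      by (simp only: mult_ac)
    then show ?thesis
      by (rule mult_left_le_imp_le) simp
  next
    case False
    then show ?thesis by (simp add: binomial_eq_0)
  qed
qed simp

lemma binomial_diff_le_power_times_binomial_Suc:
  fixes k N j :: nat
  assumes "k \<le> N" "N > 0"
  shows "real k * real ((N - k) choose j)
    \<le> real (Suc j) * (real (N - k) / real N) ^ j * real (N choose Suc j)"
proof (cases "j \<le> N - k")
  case True
  \<comment> \<open>Here \<open>j \<le> N - k\<close> gives \<open>k \<le> N - j\<close>, and the
    factor \<open>N - j\<close> is what converts \<open>N choose j\<close> into
    \<open>N choose Suc j\<close>.\<close>
  have "real k * real ((N - k) choose j)
      \<le> real (N - j) * ((real (N - k) / real N) ^ j * real (N choose j))"
    using binomial_le_power_times_binomial[of "N - k" N j] True assms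
    by (intro mult_mono) auto
  also have "\<dots> = (real (N - k) / real N) ^ j * (real (N - j) * real (N choose j))"
    by simp
  also have "\<dots> = (real (N - k) / real N) ^ j * (real (Suc j) * real (N choose Suc j))"
    unfolding of_nat_mult[symmetric] Suc_times_binomial_eq ..
  finally show ?thesis
    by (simp only: mult_ac)
next
  case False
  then show ?thesis by (simp add: binomial_eq_0)
qed

text \<open>For \<open>t < N\<close> the quotient of the square by the product of the neighbours is
  \<open>(t + 1) / t\<close> times \<open>(N - t + 1) / (N - t)\<close>. Only the first factor is
  kept, since it does not depend on \<open>N\<close>.\<close>

lemma binomial_log_concave_strong:
  assumes "t \<ge> 1"
  shows "(t + 1) * ((N choose (t - 1)) * (N choose (t + 1))) \<le> t * (N choose t)\<^sup>2"
proof -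
  obtain j where t: "t = Suc j"
    using assms by (cases t) auto
  have "(t + 1) * ((N choose (t - 1)) * (N choose (t + 1)))
      = (N choose j) * (Suc t * (N choose Suc t))"
    by (simp add: t algebra_simps)
  also have "\<dots> = (N choose j) * ((N - t) * (N choose t))"
    by (simp only: Suc_times_binomial_eq)
  also have "\<dots> \<le> ((N - j) * (N choose j)) * (N choose t)"
    by (simp add: t diff_le_mono2)
  also have "\<dots> = t * (N choose t)\<^sup>2"
    by (simp only: t Suc_times_binomial_eq[symmetric] power2_eq_square mult.assoc)
  finally show ?thesis .
qed

section \<open>Stability of log-concavity under small relative perturbations\<close>

lemma log_concave_seq_near_binomial:
  fixes a :: "nat \<Rightarrow> real"
  assumes lower: "\<And>t. t \<le> N \<Longrightarrow> real (N choose t) \<le> a t"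
    and upper: "\<And>t. t \<le> N \<Longrightarrow> a t \<le> real (N choose t) * (1 + 1 / (3 * (real t + 1)))"
  shows "log_concave_seq N a"
  unfolding log_concave_seq_def
proof
  fix t assume "t \<in> {1..<N}"
  then have t: "t \<ge> 1" "t < N" by auto
  \<comment> \<open>The tolerance at \<open>t - 1\<close> is exactly \<open>?c\<close>; the one at
    \<open>t + 1\<close> is smaller, so \<open>?c\<close> serves both neighbours.\<close>
  let ?b = "\<lambda>t. real (N choose t)" and ?c = "1 + 1 / (3 * real t)"
  have "a (t - 1) \<le> ?b (t - 1) * ?c"
    using upper[of "t - 1"] t by (simp add: of_nat_diff)
  moreover have "a (t + 1) \<le> ?b (t + 1) * ?c"
  proof -
    have "1 / (3 * (real (t + 1) + 1)) \<le> 1 / (3 * real t)"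
      using t by (intro divide_left_mono) auto
    then show ?thesis
      using upper[of "t + 1"] t
      by (smt (verit) mult_left_mono of_nat_0_le_iff Suc_eq_plus1 Suc_leI)
  qed
  ultimately have "a (t - 1) * a (t + 1) \<le> (?b (t - 1) * ?c) * (?b (t + 1) * ?c)"
    using lower[of "t + 1"] t
    by (intro mult_mono) (auto intro: order_trans[of 0 "?b (t + 1)"])
  also have "\<dots> = ?b (t - 1) * ?b (t + 1) * ?c\<^sup>2"
    by (simp add: power2_eq_square)
  also have "\<dots> \<le> ?b (t - 1) * ?b (t + 1) * ((real t + 1) / real t)"
  proof (rule mult_left_mono)
    \<comment> \<open>After clearing denominators the claim reads
      \<open>(3 * t + 1)\<^sup>2 \<le> 9 * t * (t + 1)\<close>, that is,
      \<open>1 \<le> 3 * t\<close>.\<close>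
    have "real t \<ge> 1" using t by simp
    then have "real t * real t \<ge> 1 * real t"
      by (intro mult_right_mono) auto
    with t show "?c\<^sup>2 \<le> (real t + 1) / real t"
      by (simp add: power2_eq_square field_simps)
  qed simp
  also have "\<dots> \<le> (?b t)\<^sup>2"
  proof -
    have "real ((t + 1) * ((N choose (t - 1)) * (N choose (t + 1)))) \<le> real (t * (N choose t)\<^sup>2)"
      using binomial_log_concave_strong[OF t(1)] of_nat_le_iff by blast
    then show ?thesis
      using t by (simp add: field_simps)
  qed
  also have "\<dots> \<le> (a t)\<^sup>2"
    using lower[of t] t by (intro power_mono) auto
  finally show "(a t)\<^sup>2 \<ge> a (t - 1) * a (t + 1)" .
qed

text \<open>Geometric decay beats the quadratic. With \<open>t = j + 1\<close>, one linear factor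
  comes from the ratio of binomials and the other from the tolerance
  \<open>1 / (3 * (t + 1))\<close>; boundedness in \<open>j\<close> makes the threshold for
  \<open>k\<close> independent of \<open>t\<close>.\<close>

lemma quadratic_times_power_bounded:
  fixes q :: real
  assumes "0 \<le> q" "q < 1"
  obtains B where "\<And>j::nat. real (j + 1) * real (j + 2) * q ^ j \<le> B"
proof -
  have "(\<lambda>j::nat. real (j + 1) * real (j + 2) * q ^ j) \<longlonglongrightarrow> 0"
  proof (cases "q = 0")
    case True
    have "eventually (\<lambda>j::nat. real (j + 1) * real (j + 2) * q ^ j = 0) sequentially"
      using eventually_gt_at_top[of 0] by eventually_elim (simp add: True)
    then show ?thesis
      by (rule tendsto_eventually)
  next
    case False
    with assms have "0 < q" "q < 1" by auto
    then show ?thesis by real_asymp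
  qed
  then have "Bseq (\<lambda>j::nat. real (j + 1) * real (j + 2) * q ^ j)"
    using convergent_def convergent_imp_Bseq by blast
  then obtain B where "\<And>j::nat. norm (real (j + 1) * real (j + 2) * q ^ j) \<le> B"
    using BseqE by blast
  then show ?thesis
    using that by (metis abs_le_D1 real_norm_def)
qed

text \<open>Among nonempty traces, single vertices leave the most room: each further vertex lowers
  the top by \<open>k \<ge> 1\<close> and the bottom by one, and Pascal's rule shows that this
  cannot increase the binomial.\<close>

lemma binomial_diff_le_binomial:
  assumes "k \<ge> 1" "1 \<le> s" "s \<le> n" "s \<le> t"
  shows "(k * (n - s)) choose (t - s) \<le> (k * (n - 1)) choose (t - 1)"
  using assms(2-4)
proof (induction s rule: dec_induct)
  case (step s)
  have "k * (n - s) = k * (n - Suc s) + k"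
  proof -
    have "n - s = Suc (n - Suc s)"
      using step by simp
    then show ?thesis
      by simp
  qed
  moreover have "t - s = Suc (t - Suc s)"
    using step by simp
  ultimately have "(k * (n - Suc s)) choose (t - Suc s) \<le> (k * (n - s) - 1) choose (t - Suc s)"
    using assms(1) by (intro binomial_right_mono) auto
  also have "\<dots> \<le> Suc (k * (n - s) - 1) choose (Suc (t - Suc s))"
    by simp
  also have "\<dots> = (k * (n - s)) choose (t - s)"
    using \<open>k * (n - s) = _\<close> \<open>t - s = _\<close> assms(1) by simp
  also have "\<dots> \<le> (k * (n - 1)) choose (t - 1)"
    using step by simp
  finally show ?case .
qed simp

section \<open>Independent sets of the graph with pendants\<close>

lemma card_Inl_Un_Inr:
  assumes "finite A" "finite R"
  shows "card (Inl ` A \<union> Inr ` R) = card A + card R"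
  using assms by (subst card_Un_disjoint) (auto simp: card_image)

context
  fixes G :: "'a pair_pre_digraph" and k :: nat
  assumes G: "pair_graph G"
begin

lemma finite_verts: "finite (pverts G)"
proof -
  interpret pair_graph G by (fact G)
  show ?thesis by (fact pair_finite_verts)
qed

lemma independent_set_pendants:
  "R \<subseteq> pverts G \<times> {..<k} \<Longrightarrow> independent_set (attach_pendants k G) (Inr ` R)"
  by (auto simp: independent_set_def attach_pendants_def)

text \<open>\<open>A\<close> is the trace on the original graph and \<open>R\<close> the set of
  chosen pendants, none hanging at a vertex of \<open>A\<close>. Independence of \<open>A\<close> is
  dropped, as only upper bounds are derived from this.\<close>

lemma independent_set_attach_pendantsE:
  assumes "independent_set (attach_pendants k G) S"
  obtains A R where "A \<subseteq> pverts G" "R \<subseteq> (pverts G - A) \<times> {..<k}"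
    "S = Inl ` A \<union> Inr ` R" "finite A" "finite R"
proof -
  let ?A = "Inl -` S" and ?R = "Inr -` S"
  have sub: "S \<subseteq> Inl ` pverts G \<union> Inr ` (pverts G \<times> {..<k})"
    and ind: "\<And>u v. u \<in> S \<Longrightarrow> v \<in> S \<Longrightarrow> (u, v) \<notin> parcs (attach_pendants k G)"
    using assms by (auto simp: independent_set_def attach_pendants_def)
  have A: "?A \<subseteq> pverts G"
    using sub by auto
  have R: "?R \<subseteq> (pverts G - ?A) \<times> {..<k}"
  proof
    fix p assume "p \<in> ?R"
    then obtain u j where p: "p = (u, j)" and "Inr (u, j) \<in> S"
      by (cases p) auto
    then have uj: "u \<in> pverts G" "j < k"
      using sub by auto
    moreover have "Inl u \<notin> S"
      using ind[of "Inl u" "Inr (u, j)"] \<open>Inr (u, j) \<in> S\<close> uj by (auto simp: attach_pendants_def)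
    ultimately show "p \<in> (pverts G - ?A) \<times> {..<k}"
      by (simp add: p)
  qed
  have S: "S = Inl ` ?A \<union> Inr ` ?R"
  proof (rule set_eqI)
    show "x \<in> S \<longleftrightarrow> x \<in> Inl ` ?A \<union> Inr ` ?R" for x
      by (cases x) auto
  qed
  have "finite ?A"
    using A finite_verts by (rule finite_subset)
  moreover have "finite ?R"
    using R by (rule finite_subset) (simp add: finite_verts)
  ultimately show ?thesis
    by (rule that[OF A R S])
qed

lemma finite_independent_sets: "finite {S. independent_set (attach_pendants k G) S}"
proof (rule finite_subset)
  show "{S. independent_set (attach_pendants k G) S} \<subseteq> Pow (pverts (attach_pendants k G))"
    by (auto simp: independent_set_def)
  show "finite (Pow (pverts (attach_pendants k G)))"
    by (simp add: attach_pendants_def finite_verts)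
qed

lemma independence_number_attach_pendants:
  assumes "k \<ge> 1"
  shows "independence_number (attach_pendants k G) = k * card (pverts G)"
  unfolding independence_number_def
proof (rule Max_eqI)
  show "finite {card S | S. independent_set (attach_pendants k G) S}"
    using finite_independent_sets by (auto simp: setcompr_eq_image)
next
  fix y assume "y \<in> {card S | S. independent_set (attach_pendants k G) S}"
  then obtain S where S: "independent_set (attach_pendants k G) S" and y: "y = card S"
    by auto
  obtain A R where AR: "A \<subseteq> pverts G" "R \<subseteq> (pverts G - A) \<times> {..<k}" "S = Inl ` A \<union> Inr ` R"
    and fin: "finite A" "finite R"
    using independent_set_attach_pendantsE[OF S] .
  \<comment> \<open>Each \<open>u\<close> in \<open>A\<close> is exchanged for its pendant
    \<open>(u, 0)\<close>, which exists because \<open>k \<ge> 1\<close> and is not in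
    \<open>R\<close>.\<close>
  have "card S = card (A \<times> {0::nat}) + card R"
    using fin by (simp add: AR card_Inl_Un_Inr)
  also have "\<dots> = card (A \<times> {0} \<union> R)"
    using fin AR(2) by (intro card_Un_disjoint[symmetric]) auto
  also have "\<dots> \<le> card (pverts G \<times> {..<k})"
    using AR(1,2) assms finite_verts by (intro card_mono) auto
  finally show "y \<le> k * card (pverts G)"
    using y by (simp add: card_cartesian_product mult.commute)
next
  have "card (Inr ` (pverts G \<times> {..<k}) :: ('a + 'a \<times> nat) set) = k * card (pverts G)"
    by (simp add: card_image card_cartesian_product mult.commute)
  then show "k * card (pverts G) \<in> {card S | S. independent_set (attach_pendants k G) S}"
    using independent_set_pendants[OF order_refl] by force
qed

lemma num_indep_attach_pendants_ge:
  "(k * card (pverts G)) choose t \<le> num_indep (attach_pendants k G) t"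
proof -
  let ?P = "{R. R \<subseteq> pverts G \<times> {..<k} \<and> card R = t}"
  have "(k * card (pverts G)) choose t = card ?P"
    using n_subsets[of "pverts G \<times> {..<k}" t] finite_verts by (simp add: card_cartesian_product mult.commute)
  also have "\<dots> = card (image Inr ` ?P :: ('a + 'a \<times> nat) set set)"
    by (intro card_image[symmetric] inj_onI) (auto simp: inj_image_eq_iff)
  also have "\<dots> \<le> num_indep (attach_pendants k G) t"
    unfolding num_indep_def
  proof (rule card_mono)
    show "finite {S. independent_set (attach_pendants k G) S \<and> card S = t}"
      using finite_independent_sets by (rule rev_finite_subset) auto
    show "image Inr ` ?P \<subseteq> {S. independent_set (attach_pendants k G) S \<and> card S = t}"
      using independent_set_pendants by (auto simp: card_image)
  qed
  finally show ?thesis .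
qed

text \<open>A union bound over traces: the empty trace gives the main term, and each of the at most
  \<open>2 ^ n - 1\<close> nonempty ones is bounded by the count for a single vertex.\<close>

lemma num_indep_attach_pendants_le:
  assumes "k \<ge> 1"
  shows "num_indep (attach_pendants k G) t \<le> ((k * card (pverts G)) choose t)
    + (2 ^ card (pverts G) - 1) * (if t = 0 then 0 else (k * (card (pverts G) - 1)) choose (t - 1))"
proof -
  let ?V = "pverts G" and ?n = "card (pverts G)"
  let ?sets = "\<lambda>A. {R. R \<subseteq> (?V - A) \<times> {..<k} \<and> card R = t - card A}"
  let ?T = "{A. A \<subseteq> ?V \<and> A \<noteq> {} \<and> card A \<le> t}"
  \<comment> \<open>For \<open>t = 0\<close> no nonempty trace fits, whereas truncated subtraction
    would make the binomial equal to 1.\<close>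
  let ?b = "if t = 0 then 0 else (k * (?n - 1)) choose (t - 1)"
  have fin: "finite (?sets A)" for A
    by (rule finite_subset[of _ "Pow (?V \<times> {..<k})"]) (auto simp: finite_verts)
  have card_sets: "card (?sets A) = (k * (?n - card A)) choose (t - card A)" if "A \<subseteq> ?V" for A
    using n_subsets[of "(?V - A) \<times> {..<k}" "t - card A"] finite_verts that
    by (simp add: card_cartesian_product mult.commute card_Diff_subset finite_subset)
  have finT: "finite ?T"
    by (rule finite_subset[of _ "Pow ?V"]) (auto simp: finite_verts)
  have "{S. independent_set (attach_pendants k G) S \<and> card S = t}
      \<subseteq> (\<Union>A\<in>insert {} ?T. (\<lambda>R. Inl ` A \<union> Inr ` R) ` ?sets A)" (is "?I \<subseteq> _")
  proof
    fix S assume "S \<in> ?I"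
    then have S: "independent_set (attach_pendants k G) S" "card S = t"
      by auto
    obtain A R where AR: "A \<subseteq> ?V" "R \<subseteq> (?V - A) \<times> {..<k}" "S = Inl ` A \<union> Inr ` R"
      and fin: "finite A" "finite R"
      using independent_set_attach_pendantsE[OF S(1)] .
    have "t = card A + card R"
      using card_Inl_Un_Inr[OF fin] S(2) AR(3) by simp
    then show "S \<in> (\<Union>A\<in>insert {} ?T. (\<lambda>R. Inl ` A \<union> Inr ` R) ` ?sets A)"
      using AR by (intro UN_I[of A]) auto
  qed
  then have "num_indep (attach_pendants k G) t
      \<le> card (\<Union>A\<in>insert {} ?T. (\<lambda>R. Inl ` A \<union> Inr ` R :: ('a + 'a \<times> nat) set) ` ?sets A)"
    unfolding num_indep_def using fin finT by (intro card_mono finite_UN_I) auto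
  also have "\<dots> \<le> (\<Sum>A\<in>insert {} ?T. card ((\<lambda>R. Inl ` A \<union> Inr ` R :: ('a + 'a \<times> nat) set) ` ?sets A))"
    using finT by (intro card_UN_le) auto
  also have "\<dots> \<le> (\<Sum>A\<in>insert {} ?T. card (?sets A))"
    using fin by (intro sum_mono card_image_le)
  also have "\<dots> = card (?sets {}) + (\<Sum>A\<in>?T. card (?sets A))"
    using finT by (intro sum.insert) auto
  also have "\<dots> \<le> ((k * ?n) choose t) + (2 ^ ?n - 1) * ?b"
  proof (rule add_mono)
    show "card (?sets {}) \<le> (k * ?n) choose t"
      using card_sets[of "{}"] by simp
    have "(\<Sum>A\<in>?T. card (?sets A)) \<le> (\<Sum>A\<in>?T. ?b)"
    proof (rule sum_mono)
      fix A assume "A \<in> ?T"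
      then have A: "A \<subseteq> ?V" "A \<noteq> {}" "card A \<le> t"
        by auto
      then have "1 \<le> card A" "card A \<le> ?n"
        using finite_verts by (auto simp: Suc_le_eq card_gt_0_iff finite_subset intro: card_mono)
      then show "card (?sets A) \<le> ?b"
        using binomial_diff_le_binomial[OF assms, of "card A" ?n t] A(3) card_sets[OF A(1)] by auto
    qed
    also have "\<dots> \<le> (2 ^ ?n - 1) * ?b"
    proof -
      have "card ?T \<le> card (Pow ?V - {{}})"
        by (intro card_mono) (auto simp: finite_verts)
      also have "\<dots> = 2 ^ ?n - 1"
        by (simp add: card_Diff_subset card_Pow[OF finite_verts])
      finally show ?thesis
        by (simp only: sum_constant of_nat_id mult_le_mono1)
    qed
    finally show "(\<Sum>A\<in>?T. card (?sets A)) \<le> (2 ^ ?n - 1) * ?b" .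
  qed
  finally show ?thesis .
qed

end

section \<open>Uniform closeness to the binomial sequence, and conclusion\<close>

lemma num_indep_attach_pendants_near_binomial:
  assumes "pair_graph G"
  obtains K where "\<And>k t. k \<ge> K \<Longrightarrow> real (num_indep (attach_pendants k G) t)
    \<le> real ((k * card (pverts G)) choose t) * (1 + 1 / (3 * (real t + 1)))"
proof -
  let ?n = "card (pverts G)"
  define q where "q = real (?n - 1) / real ?n"
  have q: "0 \<le> q" "q < 1"
    by (auto simp: q_def divide_less_eq)
  obtain B where B: "\<And>j::nat. real (j + 1) * real (j + 2) * q ^ j \<le> B"
    using quadratic_times_power_bounded[OF q] by blast
  \<comment> \<open>This is what remains to be bounded by \<open>k\<close> after the factors
    depending on \<open>t\<close> are absorbed into \<open>B\<close>.\<close>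
  obtain K0 :: nat where K0: "3 * 2 ^ ?n * B \<le> real K0"
    using real_arch_simple by blast
  show ?thesis
  proof (rule that[of "Suc K0"])
    fix k t assume k: "k \<ge> Suc K0"
    let ?N = "k * ?n"
    have le: "num_indep (attach_pendants k G) t \<le> (?N choose t)
        + (2 ^ ?n - 1) * (if t = 0 then 0 else (k * (?n - 1)) choose (t - 1))"
      using num_indep_attach_pendants_le[OF assms, of k t] k by simp
    show "real (num_indep (attach_pendants k G) t) \<le> real (?N choose t) * (1 + 1 / (3 * (real t + 1)))"
    \<comment> \<open>In the degenerate cases the error term is zero: the conditional vanishes at
      \<open>t = 0\<close>, and \<open>2 ^ 0 - 1 = 0\<close> for the null graph.\<close>
    proof (cases "t = 0 \<or> ?n = 0")
      case True
      then have "num_indep (attach_pendants k G) t \<le> ?N choose t"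
        using le by auto
      then have "real (num_indep (attach_pendants k G) t) \<le> real (?N choose t)"
        by simp
      also have "\<dots> \<le> real (?N choose t) * (1 + 1 / (3 * (real t + 1)))"
        by (simp add: distrib_left)
      finally show ?thesis .
    next
      case False
      then obtain j where t: "t = Suc j" and n: "?n > 0"
        by (cases t) auto
      have N: "?N > 0" "k \<le> ?N" "?N - k = k * (?n - 1)" "real (?N - k) / real ?N = q"
      proof -
        show "?N > 0" "k \<le> ?N" and *: "?N - k = k * (?n - 1)"
          using n k by (auto simp: right_diff_distrib')
        show "real (?N - k) / real ?N = q"
          unfolding * q_def of_nat_mult using k by (intro mult_divide_mult_cancel_left) simp
      qed
      let ?b = "real (?N choose t)" and ?c = "real ((?N - k) choose j)"
      have "real k * (3 * (real t + 1) * 2 ^ ?n * ?c) = 3 * (real t + 1) * 2 ^ ?n * (real k * ?c)"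
        by simp
      also have "\<dots> \<le> 3 * (real t + 1) * 2 ^ ?n * (real (Suc j) * q ^ j * ?b)"
        using binomial_diff_le_power_times_binomial_Suc[OF N(2,1), of j]
        by (intro mult_left_mono) (simp_all only: N(4) t, simp_all)
      also have "\<dots> = 3 * 2 ^ ?n * (real (j + 1) * real (j + 2) * q ^ j) * ?b"
        by (simp add: t algebra_simps)
      also have "\<dots> \<le> 3 * 2 ^ ?n * B * ?b"
        using B[of j] by (intro mult_right_mono mult_left_mono) auto
      also have "\<dots> \<le> real k * ?b"
        using K0 k by (intro mult_right_mono) auto
      finally have "3 * (real t + 1) * 2 ^ ?n * ?c \<le> ?b"
        using k by simp
      then have "2 ^ ?n * ?c \<le> ?b / (3 * (real t + 1))"
        by (simp add: field_simps)
      moreover have "real (num_indep (attach_pendants k G) t) \<le> ?b + 2 ^ ?n * ?c"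
      proof -
        have "num_indep (attach_pendants k G) t \<le> (?N choose t) + (2 ^ ?n - 1) * ((?N - k) choose j)"
          unfolding N(3) using le by (simp only: t nat.distinct if_False diff_Suc_1)
        \<comment> \<open>Enlarging \<open>2 ^ n - 1\<close> to \<open>2 ^ n\<close> removes the
          natural subtraction before the passage to reals.\<close>
        also have "\<dots> \<le> (?N choose t) + 2 ^ ?n * ((?N - k) choose j)"
          by (intro add_left_mono mult_le_mono1 diff_le_self)
        finally show ?thesis
          unfolding of_nat_le_iff[where 'a = real, symmetric] by (simp only: of_nat_add of_nat_mult of_nat_power of_nat_numeral)
      qed
      ultimately show ?thesis
        by (simp add: distrib_left)
    qed
  qed
qed

theorem proposition1p10:
  fixes G :: "'a pair_pre_digraph"
  assumes "pair_graph G"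
  shows "\<exists>K. \<forall>k\<ge>K.
           log_concave_seq (independence_number (attach_pendants k G))
             (\<lambda>t. real (num_indep (attach_pendants k G) t)) \<and>
           unimodal_seq (independence_number (attach_pendants k G))
             (\<lambda>t. real (num_indep (attach_pendants k G) t))"
proof -
  obtain K where K: "\<And>k t. k \<ge> K \<Longrightarrow> real (num_indep (attach_pendants k G) t)
      \<le> real ((k * card (pverts G)) choose t) * (1 + 1 / (3 * (real t + 1)))"
    using num_indep_attach_pendants_near_binomial[OF assms] by blast
  show ?thesis
  \<comment> \<open>The successor forces \<open>k \<ge> 1\<close>, so that the independence number
    is \<open>k * card (pverts G)\<close> and the sequence is compared with a full binomial
    row.\<close>
  proof (intro exI[of _ "Suc K"] allI impI)
    fix k assume k: "k \<ge> Suc K"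
    let ?N = "k * card (pverts G)" and ?a = "\<lambda>t. real (num_indep (attach_pendants k G) t)"
    have N: "independence_number (attach_pendants k G) = ?N"
      using independence_number_attach_pendants[OF assms] k by simp
    have lower: "real (?N choose t) \<le> ?a t" for t
      using num_indep_attach_pendants_ge[OF assms, of k t] by simp
    then have lc: "log_concave_seq ?N ?a"
      using K[of k] k by (intro log_concave_seq_near_binomial) auto
    have "?a t > 0" if "t \<le> ?N" for t
      using lower[of t] zero_less_binomial[OF that] by linarith
    then have "unimodal_seq ?N ?a"
      by (rule log_concave_seq_imp_unimodal_seq[OF lc])
    with lc show "log_concave_seq (independence_number (attach_pendants k G)) ?a \<and>
        unimodal_seq (independence_number (attach_pendants k G)) ?a"
      by (simp add: N)
  qed
qed

end
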